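(* Let $\mathcal{E}$ be an infinite connected locally finite graph. Then there is a natural isomorphism $$K_1(\mathcal{O}_{\mathcal{E}})\cong H_1(\mathcal{E}),$$ where $H_1(\mathcal{E})$ is the first (integral) homology group of the geometric realization of $\mathcal{E}$ as a one-dimensional complex.
   Context: Graphs are undirected and may have loops and multiple edges; locally finite means that each vertex has finitely many incident edges. The bi-graph $E=(E^0,E^1,s,r)$ associated to $\mathcal{E}$ is the directed graph (source $s$, range $r$) with the same vertex set in which each edge of $\mathcal{E}$ (including each loop) is replaced by a pair of edges $\{x,\overline{x}\}$ with $s(\overline{x})=r(x)$, $r(\overline{x})=s(x)$ and $\overline{\overline{x}}=x\neq\overline{x}$. Let $\mathbb{Z}^{|E^1|}$ be the free abelian group with basis $E^1$. The Bass–Hashimoto operator $\Phi\colon\mathbb{Z}^{|E^1|}\to\mathbb{Z}^{|E^1|}$ is defined on basis elements by $\Phi(x)=\Big(\sum_{x'\in E^1,\ s(x')=r(x)}x'\Big)-\overline{x}$. Its $0$–$1$ matrix $A=(A_{x,y})_{x,y\in E^1}$ is given by $\Phi(x)=\sum_y A_{x,y}\,y$, and $\mathcal{O}_{\mathcal{E}}$ is the Cuntz–Krieger $C^*$-algebra of $A$, generated by partial isometries $S_x$ ($x\in E^1$), with mutually orthogonal range projections, subject to $S_x^*S_x=\sum_y A_{x,y}S_yS_y^*$. By known results, $K_1(\mathcal{O}_{\mathcal{E}})\cong\ker(\mathrm{Id}-\Phi)$; the group $K_1$ is understood through this identification. "Natural" is used informally, meaning that the isomorphism arises from an explicit construction;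 no functoriality is asserted. *)

theory Defs
  imports "HOL-Homology.Homology" "HOL-Algebra.Free_Abelian_Groups"
    "Graph_Theory.Bidirected_Digraph"
begin

section \<open>Undirected graphs with loops and multiple edges\<close>

text \<open>The end set of an edge has two elements, or one element if the edge is a loop.\<close>

record ('v, 'e) ugraph =
  nodes :: "'v set"
  edges :: "'e set"
  ends :: "'e \<Rightarrow> 'v set"

definition wf_ugraph :: "('v, 'e) ugraph \<Rightarrow> bool" where
  "wf_ugraph G \<longleftrightarrow> (\<forall>e\<in>edges G. \<exists>u\<in>nodes G. \<exists>v\<in>nodes G. ends G e = {u, v})"

definition adjacency :: "('v, 'e) ugraph \<Rightarrow> ('v \<times> 'v) set" where
  "adjacency G = {(u, v). \<exists>e\<in>edges G. ends G e = {u, v}}"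

definition connected_ugraph :: "('v, 'e) ugraph \<Rightarrow> bool" where
  "connected_ugraph G \<longleftrightarrow> nodes G \<noteq> {} \<and> (\<forall>u\<in>nodes G. \<forall>v\<in>nodes G. (u, v) \<in> (adjacency G)\<^sup>*)"

definition locally_finite_ugraph :: "('v, 'e) ugraph \<Rightarrow> bool" where
  "locally_finite_ugraph G \<longleftrightarrow> (\<forall>v\<in>nodes G. finite {e \<in> edges G. v \<in> ends G e})"

definition infinite_ugraph :: "('v, 'e) ugraph \<Rightarrow> bool" where
  "infinite_ugraph G \<longleftrightarrow> infinite (nodes G) \<or> infinite (edges G)"

section \<open>The associated bi-graph\<close>

text \<open>An arbitrary ordering of the ends of every edge. It only serves to name the two arcs lying
  over an edge, and to parametrize that edge by the unit interval below.\<close>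

definition orientation :: "('v, 'e) ugraph \<Rightarrow> 'e \<Rightarrow> 'v \<times> 'v" where
  "orientation G e = (SOME (u, v). ends G e = {u, v})"

lemma ends_orientation:
  assumes "wf_ugraph G" "e \<in> edges G"
  shows "ends G e = {fst (orientation G e), snd (orientation G e)}"
proof -
  obtain u v where "ends G e = {u, v}"
    using assms unfolding wf_ugraph_def by blast
  then have "(\<lambda>(u, v). ends G e = {u, v}) (u, v)"
    by simp
  then have "(\<lambda>(u, v). ends G e = {u, v}) (orientation G e)"
    unfolding orientation_def by (rule someI)
  then show ?thesis
    by (simp add: case_prod_beta)
qed

text \<open>The two arcs \<open>(e, True)\<close> and \<open>(e, False)\<close> over an edge \<open>e\<close> are distinct also when
  \<open>e\<close> is a loop.\<close>

definition bi_graph :: "('v, 'e) ugraph \<Rightarrow> ('v, 'e \<times> bool) pre_digraph" where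
  "bi_graph G =
    \<lparr> verts = nodes G,
      arcs = edges G \<times> UNIV,
      tail = (\<lambda>(e, b). if b then fst (orientation G e) else snd (orientation G e)),
      head = (\<lambda>(e, b). if b then snd (orientation G e) else fst (orientation G e)) \<rparr>"

definition bi_rev :: "('v, 'e) ugraph \<Rightarrow> 'e \<times> bool \<Rightarrow> 'e \<times> bool" where
  "bi_rev G x = (if fst x \<in> edges G then (fst x, \<not> snd x) else x)"

lemma bidirected_bi_graph:
  assumes "wf_ugraph G"
  shows "bidirected_digraph (bi_graph G) (bi_rev G)"
proof -
  have *: "fst (orientation G e) \<in> nodes G" "snd (orientation G e) \<in> nodes G"
    if "e \<in> edges G" for e
  proof -
    have "ends G e \<subseteq> nodes G"
      using assms that unfolding wf_ugraph_def by fastforce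
    then show "fst (orientation G e) \<in> nodes G" "snd (orientation G e) \<in> nodes G"
      using ends_orientation[OF assms that] by auto
  qed
  show ?thesis
    by unfold_locales (auto simp: bi_graph_def bi_rev_def * split: if_splits)
qed

section \<open>The Bass--Hashimoto operator and the group \<open>K\<^sub>1\<close>\<close>

definition bass_hashimoto ::
    "('v, 'a) pre_digraph \<Rightarrow> ('a \<Rightarrow> 'a) \<Rightarrow> ('a \<Rightarrow>\<^sub>0 int) \<Rightarrow> ('a \<Rightarrow>\<^sub>0 int)" where
  "bass_hashimoto D rv =
    frag_extend (\<lambda>x. (\<Sum>x'\<in>{x' \<in> arcs D. tail D x' = head D x}. frag_of x') - frag_of (rv x))"

text \<open>The Cuntz--Krieger algebra of the 0--1 matrix \<open>A\<close> given by \<open>\<Phi>(x) = (\<Sum>y. A x y \<cdot> y)\<close> has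
  \<open>K\<^sub>1 \<cong> ker (Id - \<Phi>)\<close>; the group \<open>K\<^sub>1\<close> is understood through this identification.\<close>

definition K1_group :: "('v, 'e) ugraph \<Rightarrow> ('e \<times> bool \<Rightarrow>\<^sub>0 int) monoid" where
  "K1_group G =
    (let F = free_Abelian_group (arcs (bi_graph G));
         \<Phi> = bass_hashimoto (bi_graph G) (bi_rev G)
     in F\<lparr>carrier := kernel F F (\<lambda>z. z - \<Phi> z)\<rparr>)"

section \<open>The geometric realization\<close>

datatype ('v, 'e) rpoint = Vertex 'v | Inner 'e real

definition edge_path :: "('v, 'e) ugraph \<Rightarrow> 'e \<Rightarrow> real \<Rightarrow> ('v, 'e) rpoint" where
  "edge_path G e t =
    (if t = 0 then Vertex (fst (orientation G e))
     else if t = 1 then Vertex (snd (orientation G e))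
     else Inner e t)"

definition rpoints :: "('v, 'e) ugraph \<Rightarrow> ('v, 'e) rpoint set" where
  "rpoints G = Vertex ` nodes G \<union> {Inner e t | e t. e \<in> edges G \<and> 0 < t \<and> t < 1}"

text \<open>The weak topology of a one-dimensional CW complex, with the characteristic maps
  \<open>edge_path G e\<close> for the edges.\<close>

definition geometric_realization :: "('v, 'e) ugraph \<Rightarrow> ('v, 'e) rpoint topology" where
  "geometric_realization G =
    topology (\<lambda>U. U \<subseteq> rpoints G \<and>
      (\<forall>e\<in>edges G. openin (top_of_set {0..1}) {t \<in> {0..1}. edge_path G e t \<in> U}))"

lemma istopology_geometric_realization:
  "istopology (\<lambda>U. U \<subseteq> rpoints G \<and>
      (\<forall>e\<in>edges G. openin (top_of_set {0..1}) {t \<in> {0..1}. edge_path G e t \<in> U}))"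
proof -
  have 1: "{t \<in> {0..1}. edge_path G e t \<in> S \<inter> T} =
      {t \<in> {0..1}. edge_path G e t \<in> S} \<inter> {t \<in> {0..1}. edge_path G e t \<in> T}" for e S T
    by auto
  have 2: "{t \<in> {0..1}. edge_path G e t \<in> \<Union>\<K>} =
      (\<Union>K\<in>\<K>. {t \<in> {0..1}. edge_path G e t \<in> K})" for e \<K>
    by auto
  show ?thesis
    unfolding istopology_def
  proof (intro conjI allI impI)
    fix S T :: "('a, 'b) rpoint set"
    assume "S \<subseteq> rpoints G \<and>
        (\<forall>e\<in>edges G. openin (top_of_set {0..1}) {t \<in> {0..1}. edge_path G e t \<in> S})"
      and "T \<subseteq> rpoints G \<and>
        (\<forall>e\<in>edges G. openin (top_of_set {0..1}) {t \<in> {0..1}. edge_path G e t \<in> T})"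
    then show "S \<inter> T \<subseteq> rpoints G"
      and "\<forall>e\<in>edges G. openin (top_of_set {0..1}) {t \<in> {0..1}. edge_path G e t \<in> S \<inter> T}"
      unfolding 1 by (blast intro: openin_Int)+
  next
    fix \<K> :: "('a, 'b) rpoint set set"
    assume "\<forall>K\<in>\<K>. K \<subseteq> rpoints G \<and>
        (\<forall>e\<in>edges G. openin (top_of_set {0..1}) {t \<in> {0..1}. edge_path G e t \<in> K})"
    then show "\<Union>\<K> \<subseteq> rpoints G"
      and "\<forall>e\<in>edges G. openin (top_of_set {0..1}) {t \<in> {0..1}. edge_path G e t \<in> \<Union>\<K>}"
      unfolding 2 by (blast intro: openin_Union)+
  qed
qed

lemma openin_geometric_realization:
  "openin (geometric_realization G) U \<longleftrightarrow> U \<subseteq> rpoints G \<and>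
      (\<forall>e\<in>edges G. openin (top_of_set {0..1}) {t \<in> {0..1}. edge_path G e t \<in> U})"
  unfolding geometric_realization_def
  by (simp only: topology_inverse'[OF istopology_geometric_realization])

lemma edge_path_in_rpoints:
  assumes "wf_ugraph G" "e \<in> edges G" "t \<in> {0..1}"
  shows "edge_path G e t \<in> rpoints G"
proof -
  have "ends G e \<subseteq> nodes G"
    using assms unfolding wf_ugraph_def by fastforce
  then show ?thesis
    using ends_orientation[OF assms(1,2)] assms(2,3)
    by (auto simp: edge_path_def rpoints_def)
qed

lemma topspace_geometric_realization:
  assumes "wf_ugraph G"
  shows "topspace (geometric_realization G) = rpoints G"
proof -
  have "{t \<in> {0..1}. edge_path G e t \<in> rpoints G} = {0..1}" if "e \<in> edges G" for e
    using edge_path_in_rpoints[OF assms that] by auto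
  then have "openin (geometric_realization G) (rpoints G)"
    by (simp add: openin_geometric_realization)
  then show ?thesis
    using openin_geometric_realization[of G "topspace (geometric_realization G)"]
    by (intro subset_antisym openin_subset) simp_all
qed

text \<open>Equivalently, the realization is the quotient of the disjoint union of the discrete set of
  vertices and one copy of the unit interval for each edge.\<close>

lemma quotient_map_geometric_realization:
  fixes G :: "('v, 'e) ugraph"
  assumes "wf_ugraph G"
  shows "quotient_map
    (sum_topology
      (case_sum (\<lambda>v. discrete_topology {0}) (\<lambda>e. top_of_set {0..1 :: real}))
      (Inl ` nodes G \<union> Inr ` edges G))
    (geometric_realization G)
    (\<lambda>(c, t). case_sum Vertex (\<lambda>e. edge_path G e t) c)"
    (is "quotient_map ?X ?Y ?q")
proof -
  let ?I = "Inl ` nodes G \<union> Inr ` edges G"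
  let ?T = "case_sum (\<lambda>v :: 'v. discrete_topology {0}) (\<lambda>e :: 'e. top_of_set {0..1 :: real})"
  have ts: "topspace ?X = Sigma ?I (topspace \<circ> ?T)"
    by (rule topspace_sum_topology)
  have Inl_in: "(Inl v, t) \<in> topspace ?X \<longleftrightarrow> v \<in> nodes G \<and> t = 0" for v t
    unfolding ts by auto
  have Inr_in: "(Inr e, t) \<in> topspace ?X \<longleftrightarrow> e \<in> edges G \<and> t \<in> {0..1}" for e t
    unfolding ts by auto
  have "?q (c, t) \<in> rpoints G" if "(c, t) \<in> topspace ?X" for c t
  proof (cases c)
    case (Inl v)
    then show ?thesis using that Inl_in by (simp add: rpoints_def)
  next
    case (Inr e)
    then show ?thesis using that Inr_in edge_path_in_rpoints[OF assms] by simp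
  qed
  then have q_in: "?q ` topspace ?X \<subseteq> rpoints G"
    by (intro image_subsetI) (simp only: split_paired_all)
  have "rpoints G \<subseteq> ?q ` topspace ?X"
  proof
    fix p assume "p \<in> rpoints G"
    then consider v where "p = Vertex v" "v \<in> nodes G"
      | e t where "p = Inner e t" "e \<in> edges G" "0 < t" "t < 1"
      by (auto simp: rpoints_def)
    then show "p \<in> ?q ` topspace ?X"
    proof cases
      case (1 v)
      then have "(Inl v, 0) \<in> topspace ?X" "p = ?q (Inl v, 0)"
        unfolding Inl_in by simp_all
      then show ?thesis by (rule rev_image_eqI)
    next
      case (2 e t)
      then have "(Inr e, t) \<in> topspace ?X" "p = ?q (Inr e, t)"
        unfolding Inr_in by (simp_all add: edge_path_def)
      then show ?thesis by (rule rev_image_eqI)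
    qed
  qed
  with q_in have surj: "?q ` topspace ?X = topspace ?Y"
    unfolding topspace_geometric_realization[OF assms] by (rule subset_antisym)
  have "openin ?X {x \<in> topspace ?X. ?q x \<in> U} \<longleftrightarrow> openin ?Y U" if "U \<subseteq> topspace ?Y" for U
  proof -
    let ?W = "{x \<in> topspace ?X. ?q x \<in> U}"
    have v: "openin (?T (Inl v)) {t. (Inl v, t) \<in> ?W}" for v
      by (simp only: mem_Collect_eq Inl_in) auto
    have e: "{t. (Inr e, t) \<in> ?W} = {t \<in> {0..1}. edge_path G e t \<in> U}" if "e \<in> edges G" for e
      using that by (simp only: mem_Collect_eq Inr_in) simp
    have "?W \<subseteq> Sigma ?I (topspace \<circ> ?T)"
      unfolding ts by blast
    then have "openin ?X ?W \<longleftrightarrow> (\<forall>i\<in>?I. openin (?T i) {t. (i, t) \<in> ?W})"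
      unfolding openin_sum_topology by (simp only: simp_thms)
    also have "\<dots> \<longleftrightarrow> (\<forall>e\<in>edges G. openin (?T (Inr e)) {t. (Inr e, t) \<in> ?W})"
    proof (intro iffI ballI)
      fix e assume *: "\<forall>i\<in>?I. openin (?T i) {t. (i, t) \<in> ?W}" and "e \<in> edges G"
      then have "Inr e \<in> ?I"
        by simp
      with * show "openin (?T (Inr e)) {t. (Inr e, t) \<in> ?W}"
        by (rule bspec)
    next
      fix i assume *: "\<forall>e\<in>edges G. openin (?T (Inr e)) {t. (Inr e, t) \<in> ?W}" and "i \<in> ?I"
      from this(2) show "openin (?T i) {t. (i, t) \<in> ?W}"
      proof (elim UnE imageE)
        fix x assume "i = Inl x"
        then show ?thesis using v by simp
      next
        fix x assume "i = Inr x" "x \<in> edges G"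
        then show ?thesis using * by simp
      qed
    qed
    also have "\<dots> \<longleftrightarrow> (\<forall>e\<in>edges G.
        openin (top_of_set {0..1}) {t \<in> {0..1}. edge_path G e t \<in> U})"
      by (intro ball_cong refl) (simp only: e sum.case)
    also have "\<dots> \<longleftrightarrow> openin ?Y U"
      using that unfolding topspace_geometric_realization[OF assms] openin_geometric_realization
      by simp
    finally show ?thesis .
  qed
  with surj show ?thesis
    unfolding quotient_map_def by blast
qed

end

theory Submission
  imports Defs
begin

text \<open>Cover the realization \<open>X\<close> by the complement \<open>U\<close> of the midpoints of the edges and the union
  \<open>B\<close> of the open edges. Both deformation retract onto discrete sets, so Mayer--Vietoris identifies
  \<open>H\<^sub>1(X)\<close> with the kernel of \<open>H\<^sub>0(U \<inter> B) \<rightarrow> H\<^sub>0(U) \<oplus> H\<^sub>0(B)\<close>. The components of \<open>U \<inter> B\<close> are the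
  half edges, that is, the arcs of the bi-graph; so this is the group of all \<open>z\<close> in the free abelian
  group on the arcs with \<open>z(x) + z(rev x) = 0\<close> for every arc \<open>x\<close> and \<open>N(v) = 0\<close> for every vertex \<open>v\<close>,
  where \<open>N(v)\<close> is the sum of the coefficients of the arcs ending in \<open>v\<close>.

  On the other side, \<open>z = \<Phi>(z)\<close> means \<open>z(y) + z(rev y) = N(tail y)\<close> for every arc \<open>y\<close>. The left-hand
  side is invariant under reversal, so \<open>N\<close> is constant along edges and hence on the connected graph.
  Since \<open>N\<close> has finite support and there are infinitely many vertices, \<open>N = 0\<close>, which leaves the
  same two conditions.\<close>

section \<open>Homology of spaces that contract to a discrete set\<close>

abbreviation const_simplex :: "nat \<Rightarrow> 'a \<Rightarrow> (nat \<Rightarrow> real) \<Rightarrow> 'a" where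
  "const_simplex p a \<equiv> restrict (\<lambda>_. a) (standard_simplex p)"

abbreviation point_of_simplex :: "((nat \<Rightarrow> real) \<Rightarrow> 'a) \<Rightarrow> 'a" where
  "point_of_simplex \<sigma> \<equiv> \<sigma> (\<lambda>j. if j = 0 then 1 else 0)"

text \<open>In degree 0 this gives the coefficient sum of a chain over each component. The vertex
  with coordinate 1 at index 0 stands for the whole simplex, so the same formula serves in every
  degree; degree 1 is used too.\<close>

definition component_count :: "('a \<Rightarrow> 'c) \<Rightarrow> 'a chain \<Rightarrow> ('c \<Rightarrow>\<^sub>0 int)" where
  "component_count \<pi> = frag_extend (\<lambda>\<sigma>. frag_of (\<pi> (point_of_simplex \<sigma>)))"

definition contracts_to_discrete :: "'a topology \<Rightarrow> ('a \<Rightarrow> 'c) \<Rightarrow> ('c \<Rightarrow> 'a) \<Rightarrow> bool" where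
  "contracts_to_discrete Y \<pi> g \<longleftrightarrow>
    continuous_map Y (discrete_topology UNIV) \<pi> \<and> homotopic_with (\<lambda>_. True) Y Y id (g \<circ> \<pi>)"

text \<open>A standard simplex is connected, and connected subsets of a discrete space have at most
  one point.\<close>

lemma constant_on_simplex:
  assumes "continuous_map Y (discrete_topology UNIV) \<pi>" "singular_simplex p Y \<sigma>"
    and "x \<in> standard_simplex p" "y \<in> standard_simplex p"
  shows "\<pi> (\<sigma> x) = \<pi> (\<sigma> y)"
proof -
  let ?D = "subtopology (powertop_real UNIV) (standard_simplex p)"
  have "continuous_map ?D (discrete_topology UNIV) (\<pi> \<circ> \<sigma>)"
    using assms continuous_map_compose unfolding singular_simplex_def by blast
  moreover have "connectedin ?D (standard_simplex p)"
    using connectedin_standard_simplex by (simp add: connectedin_subtopology)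
  ultimately have "connectedin (discrete_topology UNIV) ((\<pi> \<circ> \<sigma>) ` standard_simplex p)"
    by (rule connectedin_continuous_map_image)
  then obtain a where "(\<pi> \<circ> \<sigma>) ` standard_simplex p \<subseteq> {a}"
    by (auto simp: connectedin_discrete_topology)
  then show ?thesis
    using assms by auto
qed

lemma singular_simplex_const:
  assumes "a \<in> topspace Y"
  shows "singular_simplex p Y (const_simplex p a)"
  using assms unfolding singular_simplex_def by auto

text \<open>On each singular simplex \<open>g \<circ> \<pi>\<close> is constant, so the image chain
  depends only on the component counts.\<close>

lemma chain_map_discrete:
  assumes "continuous_map Y (discrete_topology UNIV) \<pi>" "singular_chain p Y c"
  shows "chain_map p (g \<circ> \<pi>) c =
    frag_extend (\<lambda>x. frag_of (const_simplex p (g x))) (component_count \<pi> c)"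
  using assms(2) unfolding singular_chain_def
proof (induction c rule: frag_induction)
  case (one \<sigma>)
  then have "simplex_map p (g \<circ> \<pi>) \<sigma> = const_simplex p (g (\<pi> (point_of_simplex \<sigma>)))"
    unfolding simplex_map_def
    by (intro restrict_ext) (auto intro!: arg_cong[of _ _ g] constant_on_simplex[OF assms(1)])
  then show ?case
    unfolding component_count_def frag_extend_of chain_map_of by (rule arg_cong)
next
  case (diff a b)
  then show ?case
    by (simp add: chain_map_diff component_count_def frag_extend_diff)
qed (simp add: component_count_def)

text \<open>The two end points of a 1-simplex lie in the same component, so their contributions
  cancel.\<close>

lemma component_count_boundary:
  assumes "continuous_map Y (discrete_topology UNIV) \<pi>" "singular_chain (Suc 0) Y d"
  shows "component_count \<pi> (chain_boundary (Suc 0) d) = 0"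
  using assms(2) unfolding singular_chain_def
proof (induction d rule: frag_induction)
  case (one \<sigma>)
  \<comment> \<open>\<open>?e\<close> is the only point of the standard 0-simplex; the face maps
    send it to the two end points of the standard 1-simplex.\<close>
  let ?e = "\<lambda>j::nat. if j = 0 then 1 else 0 :: real"
  have e: "?e \<in> standard_simplex 0"
    by (simp add: standard_simplex_0)
  have "\<pi> (\<sigma> (simplical_face 0 ?e)) = \<pi> (\<sigma> (simplical_face (Suc 0) ?e))"
    using one by (intro constant_on_simplex[OF assms(1), where p = "Suc 0"])
      (auto intro!: simplical_face_in_standard_simplex simp: e)
  moreover have "point_of_simplex (singular_face (Suc 0) k \<sigma>) = \<sigma> (simplical_face k ?e)" for k
    using e by (simp add: singular_face_def)
  ultimately show ?case
    by (simp add: chain_boundary_of component_count_def frag_extend_diff)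
next
  case (diff a b)
  then show ?case
    by (simp add: chain_boundary_diff component_count_def frag_extend_diff)
qed (simp add: component_count_def)

text \<open>Homotopic maps induce homologous chain maps; this is applied to the identity and
  \<open>g \<circ> \<pi>\<close>.\<close>

lemma homologous_discrete:
  assumes "contracts_to_discrete Y \<pi> g" "singular_relcycle p Y {} c"
  shows "homologous_rel p Y {} c
    (frag_extend (\<lambda>x. frag_of (const_simplex p (g x))) (component_count \<pi> c))"
proof -
  have c: "singular_chain p Y c"
    using assms(2) by (simp add: singular_cycle)
  have "homotopic_with (\<lambda>h. h \<in> {} \<rightarrow> {}) Y Y id (g \<circ> \<pi>)"
    using assms(1) by (simp add: contracts_to_discrete_def)
  from homotopic_imp_homologous_rel_chain_maps[OF this assms(2)] show ?thesis
    using chain_map_discrete[OF _ c, of \<pi> g] assms(1)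
    by (simp add: chain_map_ident[OF c] contracts_to_discrete_def)
qed

text \<open>Counts vanish on boundaries. Conversely, every 0-chain is a cycle and hence homologous
  to a chain built from its counts alone, which is 0 when they vanish.\<close>

lemma boundary_iff_component_count:
  assumes "contracts_to_discrete Y \<pi> g" "singular_chain 0 Y c"
  shows "singular_relboundary 0 Y {} c \<longleftrightarrow> component_count \<pi> c = 0"
proof
  assume "singular_relboundary 0 Y {} c"
  then obtain d where "singular_chain (Suc 0) Y d" "chain_boundary (Suc 0) d = c"
    by (auto simp: singular_boundary)
  then show "component_count \<pi> c = 0"
    using component_count_boundary assms(1) unfolding contracts_to_discrete_def by blast
next
  assume "component_count \<pi> c = 0"
  moreover have "singular_relcycle 0 Y {} c"
    using assms(2) by (simp add: singular_cycle chain_boundary_def)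
  ultimately show "singular_relboundary 0 Y {} c"
    using homologous_discrete[OF assms(1), of 0 c] by (simp add: homologous_rel_def)
qed

text \<open>Every 1-cycle is homologous to a combination of constant 1-simplices, and each of these
  bounds.\<close>

lemma trivial_homology_group_contracts_to_discrete:
  assumes "contracts_to_discrete Y \<pi> g"
  shows "trivial_group (homology_group 1 Y)"
proof -
  have "singular_relboundary 1 Y {} c" if c: "singular_relcycle 1 Y {} c" for c
  proof -
    \<comment> \<open>A constant 1-simplex already bounds in the one-point subspace, where every
      chain of odd degree is a boundary.\<close>
    have *: "singular_relboundary 1 Y {} (frag_of (const_simplex 1 (g (\<pi> y))))"
      if "y \<in> topspace Y" for y
    proof -
      let ?a = "g (\<pi> y)"
      have a: "?a \<in> topspace Y"
        using assms that homotopic_with_imp_continuous_maps continuous_map_image_subset_topspace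
        unfolding contracts_to_discrete_def by fastforce
      then have ta: "topspace (subtopology Y {?a}) = {?a}"
        by auto
      then have "singular_relboundary 1 (subtopology Y {?a}) {} (frag_of (const_simplex 1 ?a))"
        by (subst singular_boundary_singleton[OF ta])
          (auto simp: singular_chain_of intro!: singular_simplex_const)
      then show ?thesis
        using singular_boundary_mono[of "{?a}" "topspace Y" 1 Y] a by simp
    qed
    \<comment> \<open>Stated for all chains rather than cycles, since induction on formal sums
      passes through summands that are not cycles.\<close>
    have "singular_relboundary 1 Y {}
        (frag_extend (\<lambda>x. frag_of (const_simplex 1 (g x))) (component_count \<pi> d))"
      if "singular_chain 1 Y d" for d
      using that unfolding singular_chain_def
    proof (induction d rule: frag_induction)
      case (one \<sigma>)
      have "\<sigma> (\<lambda>j. if j = 0 then 1 else 0) \<in> topspace Y"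
        using one by (auto simp: singular_simplex_def continuous_map_def Pi_iff)
      then show ?case
        unfolding component_count_def frag_extend_of by (rule *)
    next
      case (diff a b)
      then show ?case
        by (simp add: component_count_def frag_extend_diff singular_relboundary_diff)
    qed (simp add: component_count_def)
    with c homologous_discrete[OF assms c] show ?thesis
      unfolding homologous_rel_def singular_cycle
      using singular_relboundary_add by fastforce
  qed
  then have "homologous_rel_set 1 Y {} c = singular_relboundary_set 1 Y {}"
    if "singular_relcycle 1 Y {} c" for c
    using that by (simp only: homologous_rel_set_eq_relboundary)
  then have "carrier (homology_group (int 1) Y) \<subseteq> {\<one>\<^bsub>homology_group (int 1) Y\<^esub>}"
    unfolding carrier_relative_homology_group one_relative_homology_group by blast
  then show ?thesis
    by (simp add: group.trivial_group_subset)
qed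

section \<open>Zeroth homology as the free abelian group on the components\<close>

lemma homologous_rel_set_hom:
  "homologous_rel_set p X S \<in> hom (relcycle_group p X S) (relative_homology_group (int p) X S)"
  using normal.r_coset_hom_Mod[OF normal_subgroup_singular_relboundary_relcycle, of p X S]
  by (simp add: nontrivial_relative_homology_group right_coset_singular_relboundary)

text \<open>If every component for \<open>\<pi>\<close> lies in a single component for
  \<open>\<pi>'\<close>, as under an inclusion of spaces, counts are pushed forward along the map
  \<open>f\<close> of labels.\<close>

lemma component_count_push:
  assumes "\<And>y. y \<in> topspace Y \<Longrightarrow> \<pi>' y = f (\<pi> y)" "singular_chain 0 Y c"
  shows "component_count \<pi>' c = frag_extend (frag_of \<circ> f) (component_count \<pi> c)"
proof -
  have "\<pi>' (point_of_simplex \<sigma>) = f (\<pi> (point_of_simplex \<sigma>))" if "\<sigma> \<in> Poly_Mapping.keys c" for \<sigma>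
    using that assms
    by (auto simp: singular_chain_def singular_simplex_def continuous_map_def Pi_iff subset_iff)
  then have "component_count \<pi>' c =
      frag_extend ((frag_of \<circ> f) \<circ> (\<lambda>\<sigma>. \<pi> (point_of_simplex \<sigma>))) c"
    unfolding component_count_def by (intro frag_extend_eq) simp
  then show ?thesis
    unfolding component_count_def
    using frag_extend_compose[of "frag_of \<circ> f" "\<lambda>\<sigma>. \<pi> (point_of_simplex \<sigma>)" c]
    by (simp add: o_def)
qed

definition vertex_chain :: "('c \<Rightarrow> 'a) \<Rightarrow> ('c \<Rightarrow>\<^sub>0 int) \<Rightarrow> 'a chain" where
  "vertex_chain g = frag_extend (\<lambda>x. frag_of (const_simplex 0 (g x)))"

lemma component_count_vertex_chain:
  assumes "Poly_Mapping.keys z \<subseteq> C" "\<And>x. x \<in> C \<Longrightarrow> \<pi> (g x) = x"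
  shows "component_count \<pi> (vertex_chain g z) = z"
  using assms(1)
proof (induction z rule: frag_induction)
  case (one x)
  have "point_of_simplex (const_simplex 0 (g x)) = g x"
    by (simp add: standard_simplex_0)
  then show ?case
    using assms(2)[OF one] unfolding component_count_def vertex_chain_def frag_extend_of
    by (simp only:)
qed (simp_all add: component_count_def vertex_chain_def frag_extend_diff)

lemma singular_chain_vertex_chain:
  assumes "Poly_Mapping.keys z \<subseteq> C" "\<And>x. x \<in> C \<Longrightarrow> g x \<in> topspace Y"
  shows "singular_chain 0 Y (vertex_chain g z)"
  unfolding vertex_chain_def
proof (rule singular_chain_extend)
  fix x assume "x \<in> Poly_Mapping.keys z"
  then show "singular_chain 0 Y (frag_of (const_simplex 0 (g x)))"
    unfolding singular_chain_of using assms by (intro singular_simplex_const) auto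
qed

lemma keys_component_count:
  assumes "singular_chain 0 Y c" "\<And>y. y \<in> topspace Y \<Longrightarrow> \<pi> y \<in> C"
  shows "Poly_Mapping.keys (component_count \<pi> c) \<subseteq> C"
proof -
  have "\<pi> (point_of_simplex \<sigma>) \<in> C" if "\<sigma> \<in> Poly_Mapping.keys c" for \<sigma>
    using that assms
    by (auto simp: singular_chain_def singular_simplex_def continuous_map_def Pi_iff subset_iff)
  then show ?thesis
    using keys_frag_extend[of "\<lambda>\<sigma>. frag_of (\<pi> (point_of_simplex \<sigma>))" c]
    unfolding component_count_def by auto
qed

text \<open>Injectivity: \<open>component_count\<close> kills boundaries and recovers
  \<open>z\<close> from its vertex chain. Surjectivity: every 0-cycle is homologous to the vertex
  chain of its counts.\<close>

lemma iso_vertex_chain_zeroth_homology: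
  assumes Y: "contracts_to_discrete Y \<pi> g"
    and \<pi>C: "\<And>y. y \<in> topspace Y \<Longrightarrow> \<pi> y \<in> C"
    and gC: "\<And>x. x \<in> C \<Longrightarrow> g x \<in> topspace Y" "\<And>x. x \<in> C \<Longrightarrow> \<pi> (g x) = x"
  shows "(\<lambda>z. homologous_rel_set 0 Y {} (vertex_chain g z)) \<in>
    iso (free_Abelian_group C) (homology_group 0 Y)" (is "?k \<in> iso ?F ?H")
proof -
  have cyc: "singular_relcycle 0 Y {} c" if "singular_chain 0 Y c" for c
    using that by (simp add: singular_cycle chain_boundary_def)
  have vc: "singular_chain 0 Y (vertex_chain g z)" if "z \<in> carrier ?F" for z
    using that gC(1) by (intro singular_chain_vertex_chain[where C = C]) auto
  have "vertex_chain g \<in> hom ?F (relcycle_group 0 Y {})"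
    using vc cyc by (auto simp: hom_def vertex_chain_def frag_extend_add)
  from hom_compose[OF this homologous_rel_set_hom[of 0 Y "{}"]]
  have hom: "?k \<in> hom ?F ?H"
    by (simp add: o_def)
  have inj: "inj_on ?k (carrier ?F)"
  proof (rule inj_onI)
    fix z z' assume z: "z \<in> carrier ?F" "z' \<in> carrier ?F" "?k z = ?k z'"
    then have "homologous_rel 0 Y {} (vertex_chain g z) (vertex_chain g z')"
      by (simp only: homologous_rel_set_eq)
    then have "singular_relboundary 0 Y {} (vertex_chain g z - vertex_chain g z')"
      by (simp only: homologous_rel_def)
    then have "component_count \<pi> (vertex_chain g z - vertex_chain g z') = 0"
      using boundary_iff_component_count[OF Y] z vc by (simp add: singular_chain_diff)
    then show "z = z'"
      using component_count_vertex_chain[of z C \<pi> g] component_count_vertex_chain[of z' C \<pi> g] z gC(2)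
      by (simp add: component_count_def frag_extend_diff)
  qed
  have "c \<in> ?k ` carrier ?F" if c: "c \<in> carrier ?H" for c
  proof -
    obtain d where d: "singular_relcycle 0 Y {} d" "c = homologous_rel_set 0 Y {} d"
      using c unfolding carrier_relative_homology_group_0 by blast
    then have "homologous_rel 0 Y {} d (vertex_chain g (component_count \<pi> d))"
      unfolding vertex_chain_def by (intro homologous_discrete[OF Y])
    then have "c = ?k (component_count \<pi> d)"
      using d by (simp add: homologous_rel_set_eq)
    moreover have "component_count \<pi> d \<in> carrier ?F"
      using d keys_component_count[of Y d \<pi> C] \<pi>C by (simp add: singular_cycle)
    ultimately show ?thesis
      by blast
  qed
  moreover have "?k ` carrier ?F \<subseteq> carrier ?H"
    using hom by (auto simp: hom_def)
  ultimately show ?thesis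
    using hom inj by (auto simp: iso_def bij_betw_def)
qed

text \<open>In terms of labels, the inclusion induces the push-forward along \<open>f\<close> on
  zeroth homology, and a 0-chain bounds exactly when its counts vanish.\<close>

lemma inclusion_vertex_chain_eq_one_iff:
  assumes V: "contracts_to_discrete (subtopology X V) \<pi>' g'" and "W \<subseteq> V"
    and f: "\<And>y. y \<in> topspace (subtopology X W) \<Longrightarrow> \<pi>' y = f (\<pi> y)"
    and gC: "\<And>x. x \<in> C \<Longrightarrow> g x \<in> topspace (subtopology X W)" "\<And>x. x \<in> C \<Longrightarrow> \<pi> (g x) = x"
    and z: "Poly_Mapping.keys z \<subseteq> C"
  shows "hom_induced 0 (subtopology X W) {} (subtopology X V) {} id
      (homologous_rel_set 0 (subtopology X W) {} (vertex_chain g z))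
    = \<one>\<^bsub>homology_group 0 (subtopology X V)\<^esub> \<longleftrightarrow> frag_extend (frag_of \<circ> f) z = 0"
proof -
  let ?c = "vertex_chain g z"
  have c: "singular_chain 0 (subtopology X W) ?c"
    using z gC by (intro singular_chain_vertex_chain[where C = C]) auto
  then have cV: "singular_chain 0 (subtopology X V) ?c"
    using assms(2) by (rule singular_chain_mono)
  have cont: "continuous_map (subtopology X W) (subtopology X V) id"
    using assms(2) by (auto simp: continuous_map_in_subtopology continuous_map_from_subtopology)
  have "hom_induced 0 (subtopology X W) {} (subtopology X V) {} id
      (homologous_rel_set 0 (subtopology X W) {} ?c) = homologous_rel_set 0 (subtopology X V) {} ?c"
    using hom_induced_chain_map[OF cont, of "{}" "{}" 0 ?c] c
    by (simp add: singular_cycle chain_boundary_def chain_map_ident[OF c])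
  moreover have "\<one>\<^bsub>homology_group 0 (subtopology X V)\<^esub> = singular_relboundary_set 0 (subtopology X V) {}"
    using one_relative_homology_group[of 0] by simp
  moreover have "component_count \<pi>' ?c = frag_extend (frag_of \<circ> f) z"
    using component_count_push[of "subtopology X W" \<pi>' f \<pi> ?c, OF f c] component_count_vertex_chain[of z C \<pi> g, OF z gC(2)] by simp
  ultimately show ?thesis
    using boundary_iff_component_count[OF V cV] by (simp add: homologous_rel_set_eq_relboundary)
qed

section \<open>Mayer--Vietoris for acyclic covers\<close>

lemma hom_image_trivial_group:
  assumes "h \<in> hom G H" "trivial_group G" "group H"
  shows "h ` carrier G = {\<one>\<^bsub>H\<^esub>}"
  using assms hom_one[of h G H] by (simp add: trivial_group_def)

lemma iso_onto_image:
  assumes "h \<in> hom G H" "inj_on h (carrier G)" "h ` carrier G = L"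
  shows "h \<in> iso G (H\<lparr>carrier := L\<rparr>)"
  using assms by (auto simp: iso_def hom_def bij_betw_def)

lemma inv_into_image_Collect:
  assumes "bij_betw f A B"
  shows "inv_into A f ` {y \<in> B. P y} = {x \<in> A. P (f x)}"
proof -
  have "{y \<in> B. P y} = f ` {x \<in> A. P (f x)}"
    using assms by (auto simp: bij_betw_def)
  then show ?thesis
    using assms by (auto simp: bij_betw_def inv_into_image_cancel)
qed

text \<open>Two exact sequences joined by excision. As H_p(U) is trivial, H_p(X) embeds in H_p(X, U)
  as the kernel of the boundary map. Excision replaces the pair by (B, U \<inter> B), whose boundary
  map is injective because H_p(B) is trivial and has the kernel of \<open>i B\<close> as its
  image.\<close>

lemma mayer_vietoris_acyclic:
  assumes U: "openin X U" and B: "openin X B" and UB: "U \<union> B = topspace X"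
    and trivU: "trivial_group (homology_group p (subtopology X U))"
    and trivB: "trivial_group (homology_group p (subtopology X B))"
  defines "H \<equiv> homology_group (p - 1) (subtopology X (U \<inter> B))"
  defines "i \<equiv> \<lambda>V. hom_induced (p - 1) (subtopology X (U \<inter> B)) {} (subtopology X V) {} id"
  shows "homology_group p X \<cong> H\<lparr>carrier :=
    {c \<in> carrier H. i U c = \<one>\<^bsub>homology_group (p - 1) (subtopology X U)\<^esub> \<and>
      i B c = \<one>\<^bsub>homology_group (p - 1) (subtopology X B)\<^esub>}\<rparr>"
proof -
  let ?j = "hom_induced p X {} X U id"
  let ?XB = "subtopology X B"
  let ?R = "relative_homology_group p X U"
  let ?RB = "relative_homology_group p ?XB (U \<inter> B)"
  let ?exc = "hom_induced p ?XB (U \<inter> B) X U id"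
  let ?dU = "hom_boundary p X U" and ?dB = "hom_boundary p ?XB (U \<inter> B)"
  let ?HU = "homology_group (p - 1) (subtopology X U)"
  let ?HB = "homology_group (p - 1) ?XB"
  have sub: "subtopology ?XB (U \<inter> B) = subtopology X (U \<inter> B)"
    by (simp add: subtopology_subtopology inf.absorb2)
  have Usub: "U \<subseteq> topspace X" and Bsub: "B \<subseteq> topspace X"
    using U B openin_subset by auto
  \<comment> \<open>The excised set is the complement of \<open>B\<close>: it is closed, and it lies
    in the open set \<open>U\<close> because the two sets cover the space.\<close>
  have exc: "?exc \<in> iso ?RB ?R"
  proof -
    have "closedin X (topspace X - B)"
      using B by blast
    then have "X closure_of (topspace X - B) \<subseteq> X interior_of U"
      using U UB by (auto simp: closure_of_closedin interior_of_openin)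
    from homology_excision_axiom[OF this Usub, of p]
    have "hom_induced p (subtopology X (topspace X - (topspace X - B))) (U - (topspace X - B))
        (subtopology X (topspace X)) U id \<in> iso
        (relative_homology_group p (subtopology X (topspace X - (topspace X - B)))
          (U - (topspace X - B)))
        (relative_homology_group p (subtopology X (topspace X)) U)" .
    moreover have "topspace X - (topspace X - B) = B" "U - (topspace X - B) = U \<inter> B"
      using Usub Bsub by auto
    ultimately show ?thesis
      by simp
  qed
  have ker_dU: "kernel ?R ?HU ?dU = ?j ` carrier (homology_group p X)"
    using homology_exactness_axiom_1[of p X U] by simp
  have hj: "?j \<in> hom (homology_group p X) ?R" and hdU: "?dU \<in> hom ?R ?HU"
    and hdB: "?dB \<in> hom ?RB H" and hexc: "?exc \<in> hom ?RB ?R"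
    using hom_boundary_hom[of p ?XB "U \<inter> B"]
    by (auto simp: hom_induced_hom hom_boundary_hom H_def sub)
  have inj_j: "inj_on ?j (carrier (homology_group p X))"
  proof -
    have "kernel (homology_group p X) ?R ?j =
        hom_induced p (subtopology X U) {} X {} id ` carrier (homology_group p (subtopology X U))"
      using homology_exactness_axiom_3[of p X U] by simp
    also have "\<dots> = {\<one>\<^bsub>homology_group p X\<^esub>}"
      by (rule hom_image_trivial_group[OF hom_induced_hom trivU]) simp
    finally show ?thesis
      using hj by (subst group_hom.inj_iff_trivial_ker)
        (auto simp: group_hom_def group_hom_axioms_def)
  qed
  have inj_dB: "inj_on ?dB (carrier ?RB)"
  proof -
    have "kernel ?RB H ?dB = hom_induced p ?XB {} ?XB (U \<inter> B) id ` carrier (homology_group p ?XB)"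
      using homology_exactness_axiom_1[of p ?XB "U \<inter> B"] by (simp add: sub H_def)
    also have "\<dots> = {\<one>\<^bsub>?RB\<^esub>}"
      by (rule hom_image_trivial_group[OF hom_induced_hom trivB]) simp
    finally show ?thesis
      using hdB by (subst group_hom.inj_iff_trivial_ker)
        (auto simp: group_hom_def group_hom_axioms_def H_def)
  qed
  have img_dB: "?dB ` carrier ?RB = {c \<in> carrier H. i B c = \<one>\<^bsub>?HB\<^esub>}"
    using homology_exactness_axiom_2[of p ?XB "U \<inter> B"] by (simp add: sub H_def i_def kernel_def)
  \<comment> \<open>Naturality of the boundary map turns the kernel condition for (X, U) into a
    condition on classes of U \<inter> B.\<close>
  have nat: "?dU (?exc x) = i U (?dB x)" for x
    using naturality_hom_induced[of ?XB X id "U \<inter> B" U p] 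
    by (simp add: sub i_def fun_eq_iff continuous_map_from_subtopology)
  let ?K = "{x \<in> carrier ?RB. i U (?dB x) = \<one>\<^bsub>?HU\<^esub>}"
  let ?inv = "inv_into (carrier ?RB) ?exc"
  have iinv: "?inv \<in> iso ?R ?RB"
    using exc by (simp add: group.iso_set_sym)
  have bij: "bij_betw ?exc (carrier ?RB) (carrier ?R)"
    using exc by (simp add: iso_def)
  have img_inv: "?inv ` kernel ?R ?HU ?dU = ?K"
    unfolding kernel_def inv_into_image_Collect[OF bij] nat by (rule refl)
  \<comment> \<open>The composite H_p(X) \<rightarrow> H_p(X, U) \<rightarrow> H_p(B, U \<inter> B)
    \<rightarrow> H_(p-1)(U \<inter> B), with the inverse of excision in the middle.\<close>
  let ?h = "?dB \<circ> ?inv \<circ> ?j"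
  have "?h ` carrier (homology_group p X) = ?dB ` ?K"
    by (simp only: image_comp[symmetric] ker_dU[symmetric] img_inv)
  also have "\<dots> = {c \<in> ?dB ` carrier ?RB. i U c = \<one>\<^bsub>?HU\<^esub>}"
    by blast
  also have "\<dots> = {c \<in> carrier H. i U c = \<one>\<^bsub>?HU\<^esub> \<and> i B c = \<one>\<^bsub>?HB\<^esub>}"
    unfolding img_dB by blast
  finally have img: "?h ` carrier (homology_group p X) = \<dots>" .
  have "?inv \<in> hom ?R ?RB"
    using iinv by (simp only: iso_def mem_Collect_eq)
  from hom_compose[OF hom_compose[OF hj this] hdB]
  have "?h \<in> hom (homology_group p X) H"
    by (simp only: comp_assoc)
  moreover have "inj_on ?h (carrier (homology_group p X))"
  proof (intro comp_inj_on)
    show "inj_on ?j (carrier (homology_group p X))"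
      by (fact inj_j)
    have j: "?j ` carrier (homology_group p X) \<subseteq> carrier ?R"
      using hj by (auto simp: hom_def)
    show "inj_on ?inv (?j ` carrier (homology_group p X))"
      using bij j by (metis bij_betw_imp_surj_on inj_on_inv_into)
    show "inj_on ?dB (?inv ` ?j ` carrier (homology_group p X))"
      using inj_dB
    proof (rule inj_on_subset)
      show "?inv ` ?j ` carrier (homology_group p X) \<subseteq> carrier ?RB"
        using bij_betw_inv_into[OF bij] j by (metis bij_betw_imp_surj_on image_mono)
    qed
  qed
  ultimately show ?thesis
    using img by (intro is_isoI iso_onto_image)
qed

section \<open>Homotopies on the realization of a graph\<close>

lemma continuous_map_edge_path:
  assumes "wf_ugraph G" "e \<in> edges G"
  shows "continuous_map (top_of_set {0..1}) (geometric_realization G) (edge_path G e)"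
  unfolding continuous_map_def
  using assms edge_path_in_rpoints[OF assms]
  by (auto simp: topspace_geometric_realization openin_geometric_realization)

text \<open>Tube lemma: the quotient topology sees only one edge at a time, so the neighbourhoods on the
  edges have to be uniform in the homotopy parameter; compactness of the unit interval provides that.\<close>

lemma continuous_map_homotopy_geometric_realization:
  assumes "wf_ugraph G" and W: "openin (geometric_realization G) W"
    and edges: "\<And>e. e \<in> edges G \<Longrightarrow>
      continuous_map (top_of_set ({0..1} \<times> {t \<in> {0..1}. edge_path G e t \<in> W})) Y
        (\<lambda>(s, t). f (s, edge_path G e t))"
    and verts: "\<And>v. Vertex v \<in> W \<Longrightarrow>
      continuous_map (top_of_set {0..1}) Y (\<lambda>s. f (s, Vertex v))"
  shows "continuous_map (prod_topology (top_of_set {0..1::real})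
    (subtopology (geometric_realization G) W)) Y f"
proof -
  let ?X = "geometric_realization G"
  have Wsub: "W \<subseteq> rpoints G"
    using W by (simp add: openin_geometric_realization)
  \<comment> \<open>Inner points inherit this from their edge. Vertices need the hypothesis
    \<open>verts\<close>, since an isolated vertex lies on no edge.\<close>
  have slice: "continuous_map (top_of_set {0..1}) Y (\<lambda>s. f (s, p))" if "p \<in> W" for p
  proof (cases p)
    case (Vertex v)
    then show ?thesis using that verts by blast
  next
    case (Inner e t)
    then have e: "e \<in> edges G" "0 < t" "t < 1"
      using that Wsub by (auto simp: rpoints_def)
    then have p: "p = edge_path G e t"
      using Inner by (simp add: edge_path_def)
    have "continuous_map (top_of_set {0..1})
        (top_of_set ({0..1} \<times> {t \<in> {0..1}. edge_path G e t \<in> W})) (\<lambda>s::real. (s, t))"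
      using e p that by (auto simp: continuous_map_in_subtopology intro!: continuous_intros)
    from continuous_map_compose[OF this edges[OF e(1)]] show ?thesis
      by (simp add: p o_def)
  qed
  have top: "topspace (subtopology ?X W) = W"
    using openin_subset[OF W] by auto
  have "openin (prod_topology (top_of_set {0..1}) (subtopology ?X W))
      {x \<in> {0..1} \<times> W. f x \<in> Q}" (is "openin ?P ?S") if Q: "openin Y Q" for Q
  proof (subst openin_subopen, intro ballI)
    fix x assume "x \<in> ?S"
    then obtain s0 p0 where x: "x = (s0, p0)" and s0: "s0 \<in> {0..1}" and p0: "p0 \<in> W"
      and "f (s0, p0) \<in> Q"
      by auto
    moreover have "openin (top_of_set {0..1}) {s \<in> {0..1}. f (s, p0) \<in> Q}"
      using openin_continuous_map_preimage[OF slice[OF p0] Q] by simp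
    \<comment> \<open>A closed ball is taken so that the parameter interval \<open>?J\<close> around
      \<open>s0\<close> is compact.\<close>
    ultimately obtain \<epsilon> where "0 < \<epsilon>" and \<epsilon>: "cball s0 \<epsilon> \<inter> {0..1} \<subseteq> {s \<in> {0..1}. f (s, p0) \<in> Q}"
      unfolding openin_contains_cball by blast
    let ?J = "cball s0 \<epsilon> \<inter> {0..1}"
    have compJ: "compact ?J"
      by (simp add: compact_Int)
    define V where "V = {p \<in> W. \<forall>s\<in>?J. f (s, p) \<in> Q}"
    have "openin (top_of_set {0..1}) {t \<in> {0..1}. edge_path G e t \<in> V}" if e: "e \<in> edges G" for e
    proof -
      let ?T = "{t \<in> {0..1}. edge_path G e t \<in> W}"
      \<comment> \<open>\<open>?D\<close> holds the pairs sent outside \<open>Q\<close>. It is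
        closed, and projection along the compact \<open>?J\<close> is a closed map, so the
        parameters \<open>t\<close> that are good for all of \<open>?J\<close> form an open
        set.\<close>
      let ?D = "{z \<in> ?J \<times> ?T. (\<lambda>(s, t). f (s, edge_path G e t)) z \<in> topspace Y - Q}"
      have T: "openin (top_of_set {0..1}) ?T"
        using W e by (simp add: openin_geometric_realization)
      have "continuous_map (top_of_set (?J \<times> ?T)) Y (\<lambda>(s, t). f (s, edge_path G e t))"
        by (rule continuous_map_from_subtopology_mono[OF edges[OF e]]) auto
      moreover have "closedin Y (topspace Y - Q)"
        using Q by blast
      ultimately have "closedin (top_of_set (?J \<times> ?T)) ?D"
        using closedin_continuous_map_preimage by fastforce
      then have "closedin (top_of_set ?T) (snd ` ?D)"
        by (rule Starlike.closed_map_snd[OF compJ])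
      then have "openin (top_of_set ?T) (?T - snd ` ?D)"
        by (simp add: openin_diff)
      moreover have "{t \<in> {0..1}. edge_path G e t \<in> V} = ?T - snd ` ?D"
      proof -
        have "f (s, edge_path G e t) \<in> topspace Y" if "s \<in> ?J" "t \<in> ?T" for s t
          using continuous_map_image_subset_topspace[OF edges[OF e]] that by fastforce
        then show ?thesis
          unfolding V_def by force
      qed
      ultimately show ?thesis
        using T by (simp only: openin_trans)
    qed
    then have V: "openin (subtopology ?X W) V"
      using W Wsub by (auto simp: openin_open_subtopology openin_geometric_realization V_def)
    have "openin ?P ((ball s0 \<epsilon> \<inter> {0..1}) \<times> V)"
      using V by (auto simp: openin_prod_Times_iff openin_open intro: exI[of _ "ball s0 \<epsilon>"])
    moreover have "x \<in> (ball s0 \<epsilon> \<inter> {0..1}) \<times> V"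
      using x s0 p0 \<open>0 < \<epsilon>\<close> \<epsilon> by (auto simp: V_def)
    moreover have "(ball s0 \<epsilon> \<inter> {0..1}) \<times> V \<subseteq> ?S"
      by (auto simp: V_def)
    ultimately show "\<exists>T. openin ?P T \<and> x \<in> T \<and> T \<subseteq> ?S"
      by blast
  qed
  moreover have "f (s, p) \<in> topspace Y" if "s \<in> {0..1}" "p \<in> W" for s p
    using continuous_map_image_subset_topspace[OF slice[OF that(2)]] that by auto
  moreover have "topspace ?P = {0..1} \<times> W"
    unfolding topspace_prod_topology top by simp
  ultimately show ?thesis
    unfolding continuous_map_def by (simp add: Pi_iff)
qed

text \<open>The straight-line homotopy from \<open>t\<close> to \<open>k t\<close>, the same on all
  edges, with vertices fixed. Matching on constructors avoids choosing an edge at a vertex.\<close>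

definition slide :: "('v, 'e) ugraph \<Rightarrow> (real \<Rightarrow> real) \<Rightarrow> real \<times> ('v, 'e) rpoint \<Rightarrow> ('v, 'e) rpoint" where
  "slide G k = (\<lambda>(s, p). case p of Vertex v \<Rightarrow> Vertex v
    | Inner e t \<Rightarrow> edge_path G e ((1 - s) * t + s * k t))"

lemma slide_edge_path:
  assumes "t = 0 \<Longrightarrow> k 0 = 0" "t = 1 \<Longrightarrow> k 1 = 1"
  shows "slide G k (s, edge_path G e t) = edge_path G e ((1 - s) * t + s * k t)"
  using assms by (auto simp: slide_def edge_path_def)

text \<open>A common template for the pieces of the cover and their intersection: \<open>W\<close>
  has the same trace \<open>T\<close> on every edge, and \<open>slide G k\<close> deforms the
  identity into \<open>g \<circ> \<pi>\<close> within \<open>W\<close>.\<close>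

lemma contracts_to_discrete_slide:
  assumes wf: "wf_ugraph G" and W: "W \<subseteq> rpoints G"
    and T: "openin (top_of_set {0..1}) T"
    and WT: "\<And>e t. e \<in> edges G \<Longrightarrow> t \<in> {0..1} \<Longrightarrow> edge_path G e t \<in> W \<longleftrightarrow> t \<in> T"
    and k: "continuous_on T k" "0 \<in> T \<Longrightarrow> k 0 = 0" "1 \<in> T \<Longrightarrow> k 1 = 1"
    and kT: "\<And>s t. s \<in> {0..1} \<Longrightarrow> t \<in> T \<Longrightarrow> (1 - s) * t + s * k t \<in> T"
    and \<pi>: "\<And>e x. e \<in> edges G \<Longrightarrow> openin (top_of_set {0..1}) {t \<in> T. \<pi> (edge_path G e t) = x}"
    and gV: "\<And>v. Vertex v \<in> W \<Longrightarrow> g (\<pi> (Vertex v)) = Vertex v"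
    and gI: "\<And>e t. Inner e t \<in> W \<Longrightarrow> g (\<pi> (Inner e t)) = edge_path G e (k t)"
  shows "openin (geometric_realization G) W"
    and "contracts_to_discrete (subtopology (geometric_realization G) W) \<pi> g"
proof -
  let ?X = "geometric_realization G"
  let ?Y = "subtopology ?X W"
  have T01: "T \<subseteq> {0..1}"
    using T openin_imp_subset by blast
  have TW: "{t \<in> {0..1}. edge_path G e t \<in> W} = T" if "e \<in> edges G" for e
    using WT[OF that] T01 by auto
  show opW: "openin ?X W"
    using W T TW by (simp add: openin_geometric_realization)
  have topY: "topspace ?Y = W"
    using openin_subset[OF opW] by auto
  have sl: "slide G k (s, edge_path G e t) = edge_path G e ((1 - s) * t + s * k t)"
    if "t \<in> T" for s t e
    using that k by (intro slide_edge_path) auto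
  have inner: "e \<in> edges G" "t \<in> T" "Inner e t = edge_path G e t" if "Inner e t \<in> W" for e t
  proof -
    show e: "e \<in> edges G" and *: "Inner e t = edge_path G e t"
      using that W by (auto simp: rpoints_def edge_path_def)
    show "t \<in> T"
      using WT[OF e, of t] that W * by (auto simp: rpoints_def)
  qed
  have "continuous_map (prod_topology (top_of_set {0..1}) ?Y) ?X (slide G k)"
  proof (rule continuous_map_homotopy_geometric_realization[OF wf opW])
    fix e assume e: "e \<in> edges G"
    have "continuous_on ({0..1} \<times> T) (\<lambda>(s, t). (1 - s) * t + s * k t)"
      unfolding case_prod_beta
      by (intro continuous_intros continuous_on_compose2[OF k(1)]) auto
    moreover have "(\<lambda>(s, t). (1 - s) * t + s * k t) ` ({0..1} \<times> T) \<subseteq> {0..1}"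
      using kT T01 by fastforce
    ultimately have "continuous_map (top_of_set ({0..1} \<times> T)) (top_of_set {0..1})
        (\<lambda>(s, t). (1 - s) * t + s * k t)"
      by (auto simp: continuous_map_in_subtopology)
    from continuous_map_compose[OF this continuous_map_edge_path[OF wf e]]
    show "continuous_map (top_of_set ({0..1} \<times> {t \<in> {0..1}. edge_path G e t \<in> W})) ?X
        (\<lambda>(s, t). slide G k (s, edge_path G e t))"
      unfolding TW[OF e] by (rule continuous_map_eq) (auto simp: sl)
  next
    fix v :: 'a assume "Vertex v \<in> W"
    then show "continuous_map (top_of_set {0..1}) ?X (\<lambda>s. slide G k (s, Vertex v))"
      using openin_subset[OF opW] by (auto simp: slide_def)
  qed
  moreover have "slide G k (s, p) \<in> W" if "s \<in> {0..1}" "p \<in> W" for s p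
  proof (cases p)
    case (Vertex v)
    then show ?thesis using that by (simp add: slide_def)
  next
    case (Inner e t)
    with that have *: "e \<in> edges G" "t \<in> T" "p = edge_path G e t"
      using inner[of e t] by auto
    have "(1 - s) * t + s * k t \<in> T"
      using kT that * by blast
    then show ?thesis
      using * WT T01 by (auto simp: sl)
  qed
  ultimately have cont: "continuous_map (prod_topology (top_of_set {0..1}) ?Y) ?Y (slide G k)"
    by (auto simp: continuous_map_in_subtopology topY)
  have "homotopic_with (\<lambda>_. True) ?Y ?Y id (g \<circ> \<pi>)"
  proof (subst homotopic_with, simp, intro exI[of _ "slide G k"] conjI ballI)
    fix p assume "p \<in> topspace ?Y"
    then have p: "p \<in> W"
      by (simp add: topY)
    show "slide G k (0, p) = id p"
      using p inner by (cases p) (auto simp: slide_def)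
    show "slide G k (1, p) = (g \<circ> \<pi>) p"
      using p gV gI by (cases p) (auto simp: slide_def)
  qed (use cont in auto)
  moreover have "continuous_map ?Y (discrete_topology UNIV) \<pi>"
  proof -
    have "openin ?X {p \<in> W. \<pi> p \<in> A}" for A
    proof -
      have "openin (top_of_set {0..1}) {t \<in> {0..1}. edge_path G e t \<in> {p \<in> W. \<pi> p \<in> A}}"
        if "e \<in> edges G" for e
      proof -
        \<comment> \<open>The preimage of a set of labels is a union of preimages of single labels,
          which are open by hypothesis.\<close>
        have "{t \<in> {0..1}. edge_path G e t \<in> {p \<in> W. \<pi> p \<in> A}} =
            (\<Union>x\<in>A. {t \<in> T. \<pi> (edge_path G e t) = x})"
          using TW[OF that] by auto
        then show ?thesis
          using \<pi>[OF that] by (auto intro: openin_Union)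
      qed
      then show ?thesis
        using W by (auto simp: openin_geometric_realization)
    qed
    then show ?thesis
      unfolding continuous_map_def topY openin_open_subtopology[OF opW] by auto
  qed
  ultimately show "contracts_to_discrete ?Y \<pi> g"
    by (simp add: contracts_to_discrete_def)
qed

text \<open>Away from 1/2 the truth value of \<open>1/2 < t\<close> is locally constant.\<close>

lemma openin_off_midpoint:
  fixes T :: "real set"
  assumes "openin (top_of_set S) T" "1/2 \<notin> T"
  shows "openin (top_of_set S) {t \<in> T. P (1/2 < t)}"
proof -
  have "{t \<in> T. P (1/2 < t)} =
      T \<inter> ((if P True then {1/2<..} else {}) \<union> (if P False then {..<1/2} else {}))"
      (is "?L = ?R")
  proof (rule Set.set_eqI)
    fix t :: real
    consider "t < 1/2" | "t = 1/2" | "1/2 < t"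
      by linarith
    then show "t \<in> ?L \<longleftrightarrow> t \<in> ?R"
    proof cases
      case 2
      then have "t \<notin> T"
        using assms(2) by blast
      then show ?thesis
        by simp
    qed auto
  qed
  moreover have "open ((if P True then {1/2<..} else {}) \<union> (if P False then {..<1/2::real} else {}))"
    by auto
  ultimately show ?thesis
    using assms(1) by (simp add: openin_Int_open)
qed

text \<open>The target lies on the same side of 1/2 as \<open>t\<close>, and each side of a convex
  set is convex, so the segment never meets the midpoint.\<close>

lemma convex_comb_off_midpoint:
  fixes a b t :: real
  assumes "convex S" "t \<in> S - {1/2}" "a \<in> S" "a < 1/2" "b \<in> S" "1/2 < b" "s \<in> {0..1}"
    and k: "k = (if t < 1/2 then a else b)"
  shows "(1 - s) * t + s * k \<in> S - {1/2}"
proof (cases "t < 1/2")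
  case True
  have "convex (S \<inter> {..<1/2})"
    using assms(1) by (intro convex_Int) auto
  from convexD_alt[OF this, of t a s] show ?thesis
    using assms True by auto
next
  case False
  have "convex (S \<inter> {1/2<..})"
    using assms(1) by (intro convex_Int) auto
  from convexD_alt[OF this, of t b s] show ?thesis
    using assms False by auto
qed

section \<open>The cover of the realization and the contraction of its pieces\<close>

definition off_midpoints :: "('v, 'e) ugraph \<Rightarrow> ('v, 'e) rpoint set" where
  "off_midpoints G = {p \<in> rpoints G. \<forall>e. p \<noteq> Inner e (1/2)}"

definition open_edges :: "('v, 'e) ugraph \<Rightarrow> ('v, 'e) rpoint set" where
  "open_edges G = {Inner e t | e t. e \<in> edges G \<and> 0 < t \<and> t < 1}"

lemma bi_graph_simps:
  "arcs (bi_graph G) = edges G \<times> UNIV"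
  "tail (bi_graph G) (e, b) = (if b then fst (orientation G e) else snd (orientation G e))"
  "head (bi_graph G) (e, b) = (if b then snd (orientation G e) else fst (orientation G e))"
  by (simp_all add: bi_graph_def)

text \<open>The arc \<open>(e, True)\<close> runs from parameter 0 to 1, so its head is the end near
  parameters above 1/2. The value at a midpoint is arbitrary; midpoints are removed wherever this is
  used.\<close>

definition nearest_vertex :: "('v, 'e) ugraph \<Rightarrow> ('v, 'e) rpoint \<Rightarrow> 'v" where
  "nearest_vertex G p = (case p of Vertex v \<Rightarrow> v | Inner e t \<Rightarrow> head (bi_graph G) (e, 1/2 < t))"

text \<open>The half of an edge belongs to the arc that ends in the vertex of that half.\<close>

definition half_edge :: "('v, 'e) rpoint \<Rightarrow> 'e \<times> bool" where
  "half_edge p = (case p of Inner e t \<Rightarrow> (e, 1/2 < t))"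

lemma continuous_on_sgn_off_midpoint:
  fixes T :: "real set"
  assumes "1/2 \<notin> T"
  shows "continuous_on T (\<lambda>t. sgn (t - 1/2))"
proof (intro continuous_on_sgn continuous_intros ballI)
  show "t - 1/2 \<noteq> 0" if "t \<in> T" for t
    using assms that by (metis eq_iff_diff_eq_0)
qed

lemma contracts_off_midpoints:
  assumes wf: "wf_ugraph G"
  shows "openin (geometric_realization G) (off_midpoints G)"
    and "contracts_to_discrete (subtopology (geometric_realization G) (off_midpoints G))
      (nearest_vertex G) Vertex"
proof -
  \<comment> \<open>\<open>?k\<close> is 0 on the lower half and 1 on the upper half: each half edge
    is drawn into its end vertex.\<close>
  let ?T = "{0..1} - {1/2::real}" and ?k = "\<lambda>t::real. (1 + sgn (t - 1/2)) / 2"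
  have T: "openin (top_of_set {0..1}) ?T"
    by (simp add: openin_delete)
  have label: "nearest_vertex G (edge_path G e t) = head (bi_graph G) (e, 1/2 < t)"
    if "t \<in> {0..1}" for e t
    using that by (auto simp: nearest_vertex_def edge_path_def bi_graph_simps)
  have open_label: "openin (top_of_set {0..1}) {t \<in> ?T. nearest_vertex G (edge_path G e t) = x}"
    for e x
  proof -
    have "{t \<in> ?T. nearest_vertex G (edge_path G e t) = x} =
        {t \<in> ?T. head (bi_graph G) (e, 1/2 < t) = x}"
      using label by auto
    then show ?thesis
      using openin_off_midpoint[OF T, of "\<lambda>b. head (bi_graph G) (e, b) = x"] by simp
  qed
  have mem: "edge_path G e t \<in> off_midpoints G \<longleftrightarrow> t \<in> ?T" if "e \<in> edges G" "t \<in> {0..1}" for e t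
    using edge_path_in_rpoints[OF wf that] that by (auto simp: off_midpoints_def edge_path_def)
  have cont: "continuous_on ?T ?k"
    by (intro continuous_intros continuous_on_sgn_off_midpoint) auto
  have kT: "(1 - s) * t + s * ?k t \<in> ?T" if "s \<in> {0..1}" "t \<in> ?T" for s t
    using that by (intro convex_comb_off_midpoint[where a = 0 and b = 1]) (auto simp: sgn_if)
  have gI: "Vertex (nearest_vertex G (Inner e t)) = edge_path G e (?k t)"
    if "Inner e t \<in> off_midpoints G" for e t
    using that
    by (auto simp: off_midpoints_def rpoints_def nearest_vertex_def edge_path_def bi_graph_simps sgn_if)
  have sub: "off_midpoints G \<subseteq> rpoints G"
    by (auto simp: off_midpoints_def)
  note * = contracts_to_discrete_slide[OF wf sub T mem cont _ _ kT open_label _ gI]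
  show "openin (geometric_realization G) (off_midpoints G)"
    by (rule *(1)) (auto simp: nearest_vertex_def)
  show "contracts_to_discrete (subtopology (geometric_realization G) (off_midpoints G))
      (nearest_vertex G) Vertex"
    by (rule *(2)) (auto simp: nearest_vertex_def)
qed

text \<open>Each open edge shrinks to its midpoint. Writing the label as
  \<open>fst \<circ> half_edge\<close> makes the inclusion of the half edges act on labels as
  \<open>fst\<close>.\<close>

lemma contracts_open_edges:
  assumes wf: "wf_ugraph G"
  shows "openin (geometric_realization G) (open_edges G)"
    and "contracts_to_discrete (subtopology (geometric_realization G) (open_edges G))
      (fst \<circ> half_edge) (\<lambda>e. Inner e (1/2))"
proof -
  let ?T = "{0<..<1::real}" and ?k = "\<lambda>_::real. 1/2::real"
  have T: "openin (top_of_set {0..1}) ?T"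
    by (rule open_subset) auto
  have mem: "edge_path G e t \<in> open_edges G \<longleftrightarrow> t \<in> ?T" if "e \<in> edges G" "t \<in> {0..1}" for e t
    using that by (auto simp: open_edges_def edge_path_def)
  have open_label: "openin (top_of_set {0..1}) {t \<in> ?T. (fst \<circ> half_edge) (edge_path G e t) = x}"
    for e x
  proof -
    have "{t \<in> ?T. (fst \<circ> half_edge) (edge_path G e t) = x} = (if e = x then ?T else {})"
      by (auto simp: half_edge_def edge_path_def)
    then show ?thesis
      using T by simp
  qed
  have kT: "(1 - s) * t + s * ?k t \<in> ?T" if "s \<in> {0..1}" "t \<in> ?T" for s t
    using convexD_alt[of ?T t "1/2" s] that by auto
  have cont: "continuous_on ?T ?k"
    by simp
  have gI: "Inner ((fst \<circ> half_edge) (Inner e t)) (1/2) = edge_path G e (?k t)" for e t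
    by (auto simp: half_edge_def edge_path_def)
  have sub: "open_edges G \<subseteq> rpoints G"
    by (auto simp: open_edges_def rpoints_def)
  note * = contracts_to_discrete_slide[OF wf sub T mem cont _ _ kT open_label _ gI]
  show "openin (geometric_realization G) (open_edges G)"
    by (rule *(1)) (auto simp: open_edges_def)
  show "contracts_to_discrete (subtopology (geometric_realization G) (open_edges G))
      (fst \<circ> half_edge) (\<lambda>e. Inner e (1/2))"
    by (rule *(2)) (auto simp: open_edges_def)
qed

lemma contracts_half_edges:
  assumes wf: "wf_ugraph G"
  shows "contracts_to_discrete
    (subtopology (geometric_realization G) (off_midpoints G \<inter> open_edges G))
    half_edge (\<lambda>(e, b). Inner e (if b then 3/4 else 1/4))"
proof -
  let ?W = "off_midpoints G \<inter> open_edges G"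
  \<comment> \<open>\<open>?k\<close> takes the values 1/4 and 3/4, the centres of the two open
    halves.\<close>
  let ?T = "{0<..<1} - {1/2::real}" and ?k = "\<lambda>t::real. 1/2 + sgn (t - 1/2) / 4"
  have T: "openin (top_of_set {0..1}) ?T"
    by (rule open_subset) (auto intro: open_Diff)
  have mem: "edge_path G e t \<in> ?W \<longleftrightarrow> t \<in> ?T" if "e \<in> edges G" "t \<in> {0..1}" for e t
    using that by (auto simp: off_midpoints_def open_edges_def rpoints_def edge_path_def)
  have open_label: "openin (top_of_set {0..1}) {t \<in> ?T. half_edge (edge_path G e t) = x}" for e x
  proof -
    have "{t \<in> ?T. half_edge (edge_path G e t) = x} = {t \<in> ?T. (e, 1/2 < t) = x}"
      by (auto simp: half_edge_def edge_path_def)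
    then show ?thesis
      using openin_off_midpoint[OF T, of "\<lambda>b. (e, b) = x"] by simp
  qed
  have cont: "continuous_on ?T ?k"
    by (intro continuous_intros continuous_on_sgn_off_midpoint) auto
  have kT: "(1 - s) * t + s * ?k t \<in> ?T" if "s \<in> {0..1}" "t \<in> ?T" for s t
    using that by (intro convex_comb_off_midpoint[where a = "1/4" and b = "3/4"]) (auto simp: sgn_if)
  have gI: "(\<lambda>(e, b). Inner e (if b then 3/4 else 1/4)) (half_edge (Inner e t)) = edge_path G e (?k t)"
    if "Inner e t \<in> ?W" for e t
    using that by (auto simp: off_midpoints_def half_edge_def edge_path_def sgn_if)
  have sub: "?W \<subseteq> rpoints G"
    by (auto simp: off_midpoints_def)
  show ?thesis
    by (rule contracts_to_discrete_slide(2)[OF wf sub T mem cont _ _ kT open_label _ gI])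
      (auto simp: open_edges_def)
qed

section \<open>The kernel of the Bass--Hashimoto operator\<close>

text \<open>Every edge meets a vertex, so finitely many vertices with finitely many incident edges
  each would leave only finitely many edges.\<close>

lemma infinite_nodes:
  assumes "wf_ugraph G" "infinite_ugraph G" "locally_finite_ugraph G"
  shows "infinite (nodes G)"
proof
  assume fin: "finite (nodes G)"
  have "edges G \<subseteq> (\<Union>v\<in>nodes G. {e \<in> edges G. v \<in> ends G e})"
    using assms(1) unfolding wf_ugraph_def by blast
  moreover have "finite (\<Union>v\<in>nodes G. {e \<in> edges G. v \<in> ends G e})"
    using fin assms(3) by (auto simp: locally_finite_ugraph_def)
  ultimately show False
    using fin assms(2) finite_subset unfolding infinite_ugraph_def by blast
qed

lemma orientation_in_nodes:
  assumes "wf_ugraph G" "e \<in> edges G"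
  shows "fst (orientation G e) \<in> nodes G" "snd (orientation G e) \<in> nodes G"
proof -
  have "ends G e \<subseteq> nodes G"
    using assms unfolding wf_ugraph_def by fastforce
  then show "fst (orientation G e) \<in> nodes G" "snd (orientation G e) \<in> nodes G"
    using ends_orientation[OF assms] by auto
qed

text \<open>This makes the sum in \<open>bass_hashimoto\<close> a genuine one; over an infinite
  index set it would be 0 by convention.\<close>

lemma finite_arcs_from:
  assumes "wf_ugraph G" "locally_finite_ugraph G"
  shows "finite {y \<in> arcs (bi_graph G). tail (bi_graph G) y = v}"
proof (cases "v \<in> nodes G")
  case True
  have "{y \<in> arcs (bi_graph G). tail (bi_graph G) y = v} \<subseteq> {e \<in> edges G. v \<in> ends G e} \<times> UNIV"
    using ends_orientation[OF assms(1)] by (auto simp: bi_graph_simps split: if_splits)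
  moreover have "finite ({e \<in> edges G. v \<in> ends G e} \<times> (UNIV :: bool set))"
    using True assms(2) by (simp add: locally_finite_ugraph_def)
  ultimately show ?thesis
    by (rule finite_subset)
next
  case False
  then have "{y \<in> arcs (bi_graph G). tail (bi_graph G) y = v} = {}"
    using orientation_in_nodes[OF assms(1)] by (auto simp: bi_graph_simps)
  then show ?thesis
    by (simp only: finite.emptyI)
qed

lemma lookup_sum_frag_of:
  "finite S \<Longrightarrow> Poly_Mapping.lookup (\<Sum>x\<in>S. frag_of x) y = (if y \<in> S then 1 else 0)"
  by (induction S rule: finite_induct) (auto simp: lookup_add lookup_single)

text \<open>Reads the operator by columns: \<open>y\<close> occurs in the sum for \<open>x\<close>
  exactly when \<open>head D x = tail D y\<close>, and is subtracted exactly when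
  \<open>x = rv y\<close>.\<close>

lemma lookup_bass_hashimoto:
  assumes fin: "\<And>v. finite {y \<in> arcs D. tail D y = v}"
    and "bidirected_digraph D rv" "Poly_Mapping.keys z \<subseteq> arcs D"
  shows "Poly_Mapping.lookup (bass_hashimoto D rv z) y = (if y \<in> arcs D
    then Poly_Mapping.lookup (frag_extend (frag_of \<circ> head D) z) (tail D y)
      - Poly_Mapping.lookup z (rv y) else 0)"
  using assms(3)
proof (induction z rule: frag_induction)
  case (one x)
  interpret bidirected_digraph D rv by fact
  have "Poly_Mapping.lookup (\<Sum>x'\<in>{x' \<in> arcs D. tail D x' = head D x}. frag_of x') y =
      (if y \<in> arcs D \<and> tail D y = head D x then 1 else 0)"
    using lookup_sum_frag_of[OF fin] by simp
  moreover have "rv x = y \<longleftrightarrow> x = rv y" "rv x \<in> arcs D"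
    using one by (metis arev_arev, simp)
  ultimately show ?case
    by (auto simp: bass_hashimoto_def lookup_minus lookup_single)
next
  case (diff a b)
  then show ?case
    by (simp add: bass_hashimoto_def frag_extend_diff lookup_minus o_def)
qed (simp add: bass_hashimoto_def)

lemma lookup_push_fst:
  fixes z :: "'e \<times> bool \<Rightarrow>\<^sub>0 int"
  shows "Poly_Mapping.lookup (frag_extend (frag_of \<circ> fst) z) e =
    Poly_Mapping.lookup z (e, True) + Poly_Mapping.lookup z (e, False)"
  using subset_UNIV
proof (induction z rule: frag_induction)
  case (one x)
  obtain a b where "x = (a, b)"
    by fastforce
  then show ?case
    by (cases b) (auto simp: lookup_single when_def)
next
  case (diff a b)
  then show ?case
    by (simp add: frag_extend_diff lookup_minus o_def)
qed simp

text \<open>The conditions are phrased as push-forwards along \<open>head\<close> and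
  \<open>fst\<close> because these are the maps of labels induced by including the half edges into
  the two members of the cover.\<close>

lemma carrier_K1_group:
  assumes wf: "wf_ugraph G" and inf: "infinite_ugraph G"
    and conn: "connected_ugraph G" and lf: "locally_finite_ugraph G"
  shows "carrier (K1_group G) = {z. Poly_Mapping.keys z \<subseteq> edges G \<times> UNIV
    \<and> frag_extend (frag_of \<circ> head (bi_graph G)) z = 0 \<and> frag_extend (frag_of \<circ> fst) z = 0}"
    (is "_ = ?R")
proof -
  let ?D = "bi_graph G"
  let ?\<Phi> = "bass_hashimoto ?D (bi_rev G)"
  let ?N = "\<lambda>z. Poly_Mapping.lookup (frag_extend (frag_of \<circ> head ?D) z)"
  note bidir = bidirected_bi_graph[OF wf]
  note look = lookup_bass_hashimoto[OF finite_arcs_from[OF wf lf] bidir]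
  have "z - ?\<Phi> z = 0 \<longleftrightarrow>
      frag_extend (frag_of \<circ> head ?D) z = 0 \<and> frag_extend (frag_of \<circ> fst) z = 0"
    if z: "Poly_Mapping.keys z \<subseteq> arcs ?D" for z
  proof
    assume "z - ?\<Phi> z = 0"
    then have eq: "?N z (tail ?D y) = Poly_Mapping.lookup z y + Poly_Mapping.lookup z (bi_rev G y)"
      if "y \<in> arcs ?D" for y
      using look[OF z, of y] that by simp
    \<comment> \<open>The two arcs over \<open>e\<close> have opposite tails but the same right-hand
      side in \<open>eq\<close>.\<close>
    have edge: "?N z (fst (orientation G e)) = ?N z (snd (orientation G e))"
      "?N z (fst (orientation G e)) = Poly_Mapping.lookup z (e, True) + Poly_Mapping.lookup z (e, False)"
      if "e \<in> edges G" for e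
      using eq[of "(e, True)"] eq[of "(e, False)"] that by (simp_all add: bi_graph_simps bi_rev_def)
    have adj: "?N z u = ?N z v" if "(u, v) \<in> adjacency G" for u v
    proof -
      from that obtain e where "e \<in> edges G" "ends G e = {u, v}"
        by (auto simp: adjacency_def)
      then show ?thesis
        using edge(1)[of e] ends_orientation[OF wf, of e] by (auto simp: doubleton_eq_iff)
    qed
    have conn_eq: "?N z u = ?N z v" if "(u, v) \<in> (adjacency G)\<^sup>*" for u v
      using that by (induction rule: rtrancl_induct) (rule refl, metis adj)
    \<comment> \<open>The finite support of \<open>?N z\<close> cannot exhaust the infinite vertex
      set.\<close>
    obtain w where w: "w \<in> nodes G" "?N z w = 0"
      using infinite_nodes[OF wf inf lf] finite_keys[of "frag_extend (frag_of \<circ> head ?D) z"]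
      by (meson finite_subset in_keys_iff subsetI)
    have zero: "?N z v = 0" if "v \<in> nodes G" for v
      using conn_eq[of w v] conn w that by (simp add: connected_ugraph_def)
    moreover have "Poly_Mapping.keys (frag_extend (frag_of \<circ> head ?D) z) \<subseteq> nodes G"
    proof -
      have "head ?D x \<in> nodes G" if "x \<in> arcs ?D" for x
        using that orientation_in_nodes[OF wf] by (cases x) (auto simp: bi_graph_simps)
      moreover have "Poly_Mapping.keys (frag_extend (frag_of \<circ> head ?D) z) \<subseteq> head ?D ` arcs ?D"
        using keys_frag_extend[of "frag_of \<circ> head ?D" z] z by fastforce
      ultimately show ?thesis
        by blast
    qed
    ultimately have "?N z v = 0" for v
      by (meson in_keys_iff subsetD)
    then have "frag_extend (frag_of \<circ> head ?D) z = 0"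
      by (intro poly_mapping_eqI) simp
    moreover have "Poly_Mapping.lookup (frag_extend (frag_of \<circ> fst) z) e = 0" for e
    proof (cases "e \<in> edges G")
      case True
      then show ?thesis
        using edge(2) zero orientation_in_nodes(1)[OF wf] by (simp add: lookup_push_fst)
    next
      case False
      then have "(e, b) \<notin> Poly_Mapping.keys z" for b
        using z by (auto simp: bi_graph_simps)
      then show ?thesis
        by (simp add: lookup_push_fst in_keys_iff)
    qed
    then have "frag_extend (frag_of \<circ> fst) z = 0"
      by (intro poly_mapping_eqI) simp
    ultimately show "frag_extend (frag_of \<circ> head ?D) z = 0 \<and> frag_extend (frag_of \<circ> fst) z = 0"
      by blast
  next
    assume R: "frag_extend (frag_of \<circ> head ?D) z = 0 \<and> frag_extend (frag_of \<circ> fst) z = 0"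
    \<comment> \<open>With \<open>?N z\<close> zero, the coefficient of \<open>?\<Phi> z\<close> at
      an arc \<open>y\<close> is minus that of \<open>z\<close> at the reversed arc, hence that of
      \<open>z\<close> at \<open>y\<close>.\<close>
    have "Poly_Mapping.lookup (?\<Phi> z) y = Poly_Mapping.lookup z y" for y
    proof (cases "y \<in> arcs ?D")
      case True
      obtain e b where y: "y = (e, b)"
        by fastforce
      then have "Poly_Mapping.lookup z (e, True) + Poly_Mapping.lookup z (e, False) = 0"
        using R lookup_push_fst[of z e] by simp
      then show ?thesis
        using look[OF z, of y] True R y by (cases b) (auto simp: bi_rev_def bi_graph_simps)
    next
      case False
      then show ?thesis
        using look[OF z, of y] z by (auto simp: in_keys_iff)
    qed
    then show "z - ?\<Phi> z = 0"
      by (simp add: poly_mapping_eqI)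
  qed
  then show ?thesis
    by (auto simp: K1_group_def Let_def kernel_def bi_graph_simps)
qed

section \<open>Comparison of the two subgroups\<close>

lemma bij_betw_preimage:
  "bij_betw f A B \<Longrightarrow> L \<subseteq> B \<Longrightarrow> bij_betw f {x \<in> A. f x \<in> L} L"
  by (auto simp: bij_betw_def inj_on_def)

theorem corollary6p1:
  fixes G :: "('v, 'e) ugraph"
  assumes "wf_ugraph G"
    and "infinite_ugraph G"
    and "connected_ugraph G"
    and "locally_finite_ugraph G"
  shows "K1_group G \<cong> homology_group 1 (geometric_realization G)"
proof -
  let ?X = "geometric_realization G"
  let ?U = "off_midpoints G" and ?B = "open_edges G"
  let ?W = "?U \<inter> ?B"
  let ?Y = "subtopology ?X ?W"
  let ?F = "free_Abelian_group (edges G \<times> (UNIV :: bool set))"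
  let ?g = "\<lambda>(e, b). Inner e (if b then 3/4 else 1/4 :: real) :: ('v, 'e) rpoint"
  let ?H = "homology_group 0 ?Y"
  let ?i = "\<lambda>V. hom_induced 0 ?Y {} (subtopology ?X V) {} id"
  \<comment> \<open>\<open>?k\<close> sends an arc to the class of the centre of its half edge;
    restricted to \<open>K1_group G\<close> it is the explicit isomorphism onto the Mayer--Vietoris
    kernel \<open>?L\<close>.\<close>
  let ?k = "\<lambda>z. homologous_rel_set 0 ?Y {} (vertex_chain ?g z)"
  let ?L = "{c \<in> carrier ?H. ?i ?U c = \<one>\<^bsub>homology_group 0 (subtopology ?X ?U)\<^esub> \<and>
      ?i ?B c = \<one>\<^bsub>homology_group 0 (subtopology ?X ?B)\<^esub>}"
  note wf = assms(1)
  note U = contracts_off_midpoints[OF wf] and B = contracts_open_edges[OF wf]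
    and W = contracts_half_edges[OF wf]
  have top: "topspace ?X = rpoints G"
    by (rule topspace_geometric_realization[OF wf])
  then have "?U \<union> ?B = topspace ?X"
    by (auto simp: off_midpoints_def open_edges_def rpoints_def)
  from mayer_vietoris_acyclic[OF U(1) B(1) this, of 1]
  have MV: "homology_group 1 ?X \<cong> ?H\<lparr>carrier := ?L\<rparr>"
    using trivial_homology_group_contracts_to_discrete[OF U(2)]
      trivial_homology_group_contracts_to_discrete[OF B(2)] by simp
  have topY: "topspace ?Y = ?W"
    by (auto simp: top off_midpoints_def)
  have gC: "?g x \<in> topspace ?Y" "half_edge (?g x) = x" if "x \<in> edges G \<times> UNIV" for x
  proof -
    obtain e b where x: "x = (e, b)"
      by fastforce
    have "Inner e t \<in> ?W" if "0 < t" "t < 1" "t \<noteq> 1/2" for t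
      using that \<open>x \<in> _\<close> x by (auto simp: off_midpoints_def open_edges_def rpoints_def)
    then show "?g x \<in> topspace ?Y"
      unfolding topY x by (cases b) simp_all
    show "half_edge (?g x) = x"
      unfolding x by (cases b) (simp_all add: half_edge_def)
  qed
  have piC: "half_edge y \<in> edges G \<times> UNIV" if "y \<in> topspace ?Y" for y
    using that unfolding topY by (auto simp: open_edges_def half_edge_def)
  have isoF: "?k \<in> iso ?F ?H"
    by (rule iso_vertex_chain_zeroth_homology[OF W piC gC])
  \<comment> \<open>A half edge lies in the star of the head of its arc.\<close>
  have iU: "?i ?U (?k z) = \<one>\<^bsub>homology_group 0 (subtopology ?X ?U)\<^esub> \<longleftrightarrow>
      frag_extend (frag_of \<circ> head (bi_graph G)) z = 0" if "z \<in> carrier ?F" for z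
  proof (rule inclusion_vertex_chain_eq_one_iff[OF U(2) _ _ gC])
    fix y assume "y \<in> topspace ?Y"
    then show "nearest_vertex G y = head (bi_graph G) (half_edge y)"
      unfolding topY by (auto simp: open_edges_def nearest_vertex_def half_edge_def)
  qed (use that in simp_all)
  have iB: "?i ?B (?k z) = \<one>\<^bsub>homology_group 0 (subtopology ?X ?B)\<^esub> \<longleftrightarrow>
      frag_extend (frag_of \<circ> fst) z = 0" if "z \<in> carrier ?F" for z
    by (rule inclusion_vertex_chain_eq_one_iff[OF B(2) _ _ gC]) (use that in simp_all)
  \<comment> \<open>The kernel conditions on the two sides agree term by term, so the group is the
    preimage of \<open>?L\<close> under \<open>?k\<close>.\<close>
  have carr: "carrier (K1_group G) = {z \<in> carrier ?F. ?k z \<in> ?L}"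
  proof (rule Set.set_eqI)
    fix z
    have "z \<in> carrier (K1_group G) \<longleftrightarrow> z \<in> carrier ?F
        \<and> frag_extend (frag_of \<circ> head (bi_graph G)) z = 0 \<and> frag_extend (frag_of \<circ> fst) z = 0"
      unfolding carrier_K1_group[OF assms] by simp
    moreover have "?k z \<in> carrier ?H" if "z \<in> carrier ?F"
      using that isoF unfolding iso_def bij_betw_def by blast
    ultimately show "z \<in> carrier (K1_group G) \<longleftrightarrow> z \<in> {z \<in> carrier ?F. ?k z \<in> ?L}"
      using iU[of z] iB[of z] by blast
  qed
  have "?k \<in> iso (K1_group G) (?H\<lparr>carrier := ?L\<rparr>)"
  proof -
    have bij: "bij_betw ?k (carrier ?F) (carrier ?H)" and hom: "?k \<in> hom ?F ?H"
      using isoF by (auto simp: iso_def)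
    have L: "?L \<subseteq> carrier ?H"
      by (rule subsetI, erule CollectE, erule conjE, assumption)
    have "?k (x \<otimes>\<^bsub>K1_group G\<^esub> y) = ?k x \<otimes>\<^bsub>?H\<^esub> ?k y"
      if "x \<in> carrier (K1_group G)" "y \<in> carrier (K1_group G)" for x y
    proof -
      have "x \<otimes>\<^bsub>K1_group G\<^esub> y = x \<otimes>\<^bsub>?F\<^esub> y"
        by (simp add: K1_group_def Let_def free_Abelian_group_def)
      then show ?thesis
        using that hom_mult[OF hom, of x y] unfolding carr by simp
    qed
    moreover have "?k z \<in> carrier ?H" if "z \<in> carrier (K1_group G)" for z
      using that hom_in_carrier[OF hom] unfolding carr by blast
    ultimately have "?k \<in> hom (K1_group G) ?H"
      by (intro homI)
    moreover have "bij_betw ?k (carrier (K1_group G)) ?L"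
      unfolding carr by (rule bij_betw_preimage[OF bij L])
    ultimately show ?thesis
      by (intro iso_onto_image bij_betw_imp_inj_on bij_betw_imp_surj_on)
  qed
  then have "K1_group G \<cong> ?H\<lparr>carrier := ?L\<rparr>"
    by (rule is_isoI)
  moreover have "?H\<lparr>carrier := ?L\<rparr> \<cong> homology_group 1 ?X"
    by (rule group.iso_sym[OF group_relative_homology_group MV])
  ultimately show ?thesis
    by (rule iso_trans)
qed

end
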